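(* Let $M$ be a multiset with $|M|\geq 2$. There exists an involution $\Psi:\mathcal{T}_M\to\mathcal{T}_M$ such that for every $T\in\mathcal{T}_M$, $$(\mathsf{snuleaf},\mathsf{etleaf},\mathsf{syleaf},\mathsf{yerleaf})(\Psi(T))=(\mathsf{snuleaf},\mathsf{etleaf},\mathsf{syleaf},\mathsf{yerleaf})(T)$$ and $$(\mathsf{suleaf},\mathsf{entleaf})(\Psi(T))=(\mathsf{entleaf},\mathsf{suleaf})(T).$$ Moreover, $\mathsf{yint}(\Psi(T))=\mathsf{yint}(T)$ for every $T\in\mathcal{T}_M$, and so $\Psi$ restricts to an involution on $\mathcal{A}_M$. Consequently, for every $n\ge 2$, $$M_n(u_1,u_2,u_3;v_1,v_2)=M_n(u_3,u_2,u_1;v_1,v_2).$$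
   Context: A plane tree is a rooted tree in which the children of each node are linearly ordered (from left to right). $M=\{1^{p_1},2^{p_2},\ldots,r^{p_r}\}$ is a multiset in which $i$ has multiplicity $p_i$ ($r\ge1$, all $p_i\ge1$), with cardinality $|M|=p_1+\cdots+p_r$. A weakly increasing tree on $M$ is a plane tree with $|M|+1$ nodes that are labeled precisely by all elements of the multiset $M\cup\{0\}$ such that (i) the labels along a path from the root to any leaf are weakly increasing; (ii) the labels of the children of each node are weakly increasing from right to left. $\mathcal{T}_M$ is the set of weakly increasing trees on $M$. A leaf is a node without children; an internal node is a node with at least one child. The elder siblings of a node are its siblings to its left; the "second child" of a node is its second child from the left. A leaf is an old leaf if it is the leftmost child of its parent, and a young leaf otherwise. An old leaf is a singleton leaf if it is the only child of its parent, and an elder leaf if it has siblings. An internal node is an elder internal node if it is the parent of an elder leaf, a singleton internal node if it is the parent of a singleton leaf, and a young internal node otherwise; $\mathsf{yint}(T)$ is the number of young internal nodes of $T$, and $\mathcal{A}_M$ is the set of trees $T\in\mathcal{T}_M$ with $\mathsf{yint}(T)=0$. Further statistics of $T\in\mathcal{T}_M$: $\mathsf{sleaf}(T)$ is the number of singleton leaves; $\mathsf{suleaf}(T)$ (resp. $\mathsf{snuleaf}(T)$) is the number of singleton leaves whose parent has elder siblings (resp. has no elder sibling); $\mathsf{etleaf}(T)$ (resp. $\mathsf{entleaf}(T)$) is the number of elder leaves such that the second child of their parent is a leaf (resp. is not a leaf); $\mathsf{syleaf}(T)$ (resp. $\mathsf{yerleaf}(T)$) is the number of young leaves that are (resp.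 are not) the second child of their parent. Finally, $\mathcal{A}_{n+1}:=\mathcal{A}_{\{1^{n+1}\}}$ (equivalently, the set of plane trees with $n+1$ edges and no young internal node), and $$M_n(u_1,u_2,u_3;v_1,v_2):=\sum_{T\in \mathcal{A}_{n+1}}u_1^{\mathsf{sleaf}(T)} u_2^{\mathsf{etleaf}(T)} u_3^{\mathsf{entleaf}(T)} v_1^{\mathsf{yerleaf}(T)} v_2^{\mathsf{syleaf}(T)}.$$ *)

theory Defs
  imports "HOL-Library.Multiset" "HOL-Library.FuncSet"
begin

text \<open>The children of a node are listed from left to right.\<close>

datatype ltree = Node (label: nat) (children: "ltree list")

primrec labels :: "ltree \<Rightarrow> nat multiset" where
  "labels (Node a ts) = add_mset a (sum_list (map labels ts))"

text \<open>
  A node of a tree is identified with its address: the list of child positions (counted from 0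
  at the left) met on the path from the root to the node. Thus the root is \<open>[]\<close>, the parent of
  a node \<open>x \<noteq> []\<close> is \<open>butlast x\<close>, and \<open>last x\<close> is the number of elder siblings of \<open>x\<close>.
\<close>

primrec is_node :: "ltree \<Rightarrow> nat list \<Rightarrow> bool" where
  "is_node t [] \<longleftrightarrow> True"
| "is_node t (i # x) \<longleftrightarrow> i < length (children t) \<and> is_node (children t ! i) x"

primrec subtree_at :: "ltree \<Rightarrow> nat list \<Rightarrow> ltree" where
  "subtree_at t [] = t"
| "subtree_at t (i # x) = subtree_at (children t ! i) x"

definition nodes :: "ltree \<Rightarrow> nat list set" where
  "nodes t = {x. is_node t x}"

definition childs_at :: "ltree \<Rightarrow> nat list \<Rightarrow> ltree list" where
  "childs_at t x = children (subtree_at t x)"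

definition leaf :: "ltree \<Rightarrow> nat list \<Rightarrow> bool" where
  "leaf t x \<longleftrightarrow> x \<in> nodes t \<and> length (childs_at t x) = 0"

definition internal :: "ltree \<Rightarrow> nat list \<Rightarrow> bool" where
  "internal t x \<longleftrightarrow> x \<in> nodes t \<and> length (childs_at t x) \<ge> 1"

text \<open>The labels on the path from the root to the node \<open>x\<close>, both ends included.\<close>

primrec path_labels :: "ltree \<Rightarrow> nat list \<Rightarrow> nat list" where
  "path_labels t [] = [label t]"
| "path_labels t (i # x) = label t # path_labels (children t ! i) x"

definition weakly_increasing :: "ltree \<Rightarrow> bool" where
  "weakly_increasing t \<longleftrightarrow>
     (\<forall>x. leaf t x \<longrightarrow> sorted (path_labels t x)) \<and>
     (\<forall>x\<in>nodes t. sorted (rev (map label (childs_at t x))))"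

text \<open>The multisets \<open>{1^p\<^sub>1, \<dots>, r^p\<^sub>r}\<close> with \<open>r \<ge> 1\<close> and all \<open>p\<^sub>i \<ge> 1\<close>.\<close>

definition label_multiset :: "nat multiset \<Rightarrow> bool" where
  "label_multiset M \<longleftrightarrow> (\<exists>r\<ge>1. set_mset M = {1..r})"

definition wi_trees :: "nat multiset \<Rightarrow> ltree set" where
  "wi_trees M = {t. labels t = add_mset 0 M \<and> weakly_increasing t}"

text \<open>
  The tree with one node, whose root would be a leaf without a parent, never occurs in
  \<open>wi_trees M\<close> for nonempty \<open>M\<close>.
\<close>

definition old_leaf :: "ltree \<Rightarrow> nat list \<Rightarrow> bool" where
  "old_leaf t x \<longleftrightarrow> leaf t x \<and> x \<noteq> [] \<and> last x = 0"

definition young_leaf :: "ltree \<Rightarrow> nat list \<Rightarrow> bool" where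
  "young_leaf t x \<longleftrightarrow> leaf t x \<and> \<not> old_leaf t x"

definition singleton_leaf :: "ltree \<Rightarrow> nat list \<Rightarrow> bool" where
  "singleton_leaf t x \<longleftrightarrow> old_leaf t x \<and> length (childs_at t (butlast x)) = 1"

definition elder_leaf :: "ltree \<Rightarrow> nat list \<Rightarrow> bool" where
  "elder_leaf t x \<longleftrightarrow> old_leaf t x \<and> length (childs_at t (butlast x)) \<ge> 2"

definition elder_internal :: "ltree \<Rightarrow> nat list \<Rightarrow> bool" where
  "elder_internal t x \<longleftrightarrow> internal t x \<and> (\<exists>y. elder_leaf t y \<and> butlast y = x)"

definition singleton_internal :: "ltree \<Rightarrow> nat list \<Rightarrow> bool" where
  "singleton_internal t x \<longleftrightarrow> internal t x \<and> (\<exists>y. singleton_leaf t y \<and> butlast y = x)"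

definition young_internal :: "ltree \<Rightarrow> nat list \<Rightarrow> bool" where
  "young_internal t x \<longleftrightarrow> internal t x \<and> \<not> elder_internal t x \<and> \<not> singleton_internal t x"

definition has_elder_sibling :: "nat list \<Rightarrow> bool" where
  "has_elder_sibling x \<longleftrightarrow> x \<noteq> [] \<and> last x \<ge> 1"

definition is_second_child :: "nat list \<Rightarrow> bool" where
  "is_second_child x \<longleftrightarrow> x \<noteq> [] \<and> last x = 1"

definition second_child :: "nat list \<Rightarrow> nat list" where
  "second_child x = x @ [1]"

definition yint :: "ltree \<Rightarrow> nat" where
  "yint t = card {x. young_internal t x}"

definition sleaf :: "ltree \<Rightarrow> nat" where
  "sleaf t = card {x. singleton_leaf t x}"

definition suleaf :: "ltree \<Rightarrow> nat" where
  "suleaf t = card {x. singleton_leaf t x \<and> has_elder_sibling (butlast x)}"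

definition snuleaf :: "ltree \<Rightarrow> nat" where
  "snuleaf t = card {x. singleton_leaf t x \<and> \<not> has_elder_sibling (butlast x)}"

definition etleaf :: "ltree \<Rightarrow> nat" where
  "etleaf t = card {x. elder_leaf t x \<and> leaf t (second_child (butlast x))}"

definition entleaf :: "ltree \<Rightarrow> nat" where
  "entleaf t = card {x. elder_leaf t x \<and> \<not> leaf t (second_child (butlast x))}"

definition syleaf :: "ltree \<Rightarrow> nat" where
  "syleaf t = card {x. young_leaf t x \<and> is_second_child x}"

definition yerleaf :: "ltree \<Rightarrow> nat" where
  "yerleaf t = card {x. young_leaf t x \<and> \<not> is_second_child x}"

definition A_trees :: "nat multiset \<Rightarrow> ltree set" where
  "A_trees M = {t \<in> wi_trees M. yint t = 0}"

definition involution_on :: "'b set \<Rightarrow> ('b \<Rightarrow> 'b) \<Rightarrow> bool" where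
  "involution_on S f \<longleftrightarrow> f \<in> S \<rightarrow> S \<and> (\<forall>x\<in>S. f (f x) = x)"

text \<open>
  The polynomial \<open>M\<^sub>n\<close> evaluated at elements of an arbitrary commutative semiring. An identity
  that holds for all arguments in all such semirings is an identity of polynomials, since the
  arguments may be the indeterminates of a polynomial ring.
\<close>

definition M_poly :: "nat \<Rightarrow> 'a \<Rightarrow> 'a \<Rightarrow> 'a \<Rightarrow> 'a \<Rightarrow> 'a \<Rightarrow> 'a::comm_semiring_1" where
  "M_poly n u1 u2 u3 v1 v2 =
     (\<Sum>T\<in>A_trees (replicate_mset (n + 1) 1).
        u1 ^ sleaf T * u2 ^ etleaf T * u3 ^ entleaf T * v1 ^ yerleaf T * v2 ^ syleaf T)"

text \<open>All cardinalities and sums above range over finite sets.\<close>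

lemma finite_nodes: "finite (nodes t)"
proof (induction t)
  case (Node a ts)
  have "nodes (Node a ts) \<subseteq> insert [] (\<Union>i<length ts. (#) i ` nodes (ts ! i))"
  proof
    fix x assume "x \<in> nodes (Node a ts)"
    then show "x \<in> insert [] (\<Union>i<length ts. (#) i ` nodes (ts ! i))"
      by (cases x) (auto simp: nodes_def)
  qed
  moreover have "finite (nodes (ts ! i))" if "i < length ts" for i
    using Node that by simp
  ultimately show ?case
    by (auto intro: finite_subset)
qed

lemma labels_nonempty: "labels t \<noteq> {#}"
  by (cases t) simp

lemma finite_trees_bounded:
  assumes "finite A"
  shows "finite {t. size (labels t) \<le> k \<and> set_mset (labels t) \<subseteq> A}" (is "finite (?F k)")
proof (induction k)
  case 0
  then show ?case by (simp add: labels_nonempty)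
next
  case (Suc k)
  have len: "length ts \<le> size (sum_list (map labels ts))" for ts
  proof (induction ts)
    case (Cons t ts)
    have "size (labels t) \<ge> 1" using labels_nonempty[of t] by (simp add: Suc_le_eq nonempty_has_size)
    with Cons show ?case by simp
  qed simp
  have sub: "labels t \<subseteq># sum_list (map labels ts)" if "t \<in> set ts" for t ts
    using that by (induction ts) (auto intro: subset_mset.trans)
  have "?F (Suc k) \<subseteq> (\<lambda>(a, ts). Node a ts) ` (A \<times> {ts. set ts \<subseteq> ?F k \<and> length ts \<le> k})"
  proof
    fix t assume t: "t \<in> ?F (Suc k)"
    obtain a ts where [simp]: "t = Node a ts" by (cases t)
    have "t' \<in> ?F k" if "t' \<in> set ts" for t'
      using size_mset_mono[OF sub[OF that]] set_mset_mono[OF sub[OF that]] t that by fastforce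
    moreover have "length ts \<le> k" using len[of ts] t by simp
    ultimately show "t \<in> (\<lambda>(a, ts). Node a ts) ` (A \<times> {ts. set ts \<subseteq> ?F k \<and> length ts \<le> k})"
      using t by (auto simp: image_iff)
  qed
  moreover have "finite (A \<times> {ts. set ts \<subseteq> ?F k \<and> length ts \<le> k})"
    using assms Suc finite_lists_length_le by blast
  ultimately show ?case by (meson finite_imageI finite_subset)
qed

lemma finite_wi_trees: "finite (wi_trees M)"
  by (rule finite_subset[OF _ finite_trees_bounded[of "insert 0 (set_mset M)" "Suc (size M)"]])
    (auto simp: wi_trees_def)

end

theory Submission
  imports Defs
begin

text \<open>
  The rightmost tree of a nonempty forest splits the forest as \<open>G @ [Node x H]\<close>. Iterating
  this turns a forest into a binary tree: the node \<open>x\<close> gets its elder siblings \<open>G\<close> on one side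
  and its children \<open>H\<close> on the other. The involution is the mirror image of this binary tree,
  with one restriction: \<open>G\<close> and \<open>H\<close> are exchanged only where both are nonempty. Leaves and leftmost
  children thus stay what they are. The root label is kept and the forest of its children is
  mirrored (\<open>mirror_tree\<close>).

  The condition of weak increase is symmetric in this encoding: \<open>Node a (G @ [Node x H])\<close> is weakly
  increasing iff \<open>a \<le> x\<close> and both \<open>Node x G\<close> and \<open>Node x H\<close> are
  (\<open>weakly_increasing_snoc\<close>), because \<open>x\<close> is the least label allowed to its elder siblings as
  well as to its children. So mirroring maps \<open>wi_trees M\<close> to itself.

  Every statistic counts the non-root nodes for which the pair of \<open>G\<close> (elder siblings) and \<open>H\<close>
  (children) has a certain shape. Say that a forest is lone if it is a single leaf. Then, if the
  root has children and its children do not form a lone forest,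

    \<^item> \<open>entleaf\<close> counts the nodes with \<open>G\<close> lone and \<open>H\<close> nonempty: the node is the second child
      next to the elder leaf;
    \<^item> \<open>suleaf\<close> counts those with \<open>G\<close> nonempty and \<open>H\<close> lone: the node is the parent of the
      singleton leaf;
    \<^item> \<open>etleaf\<close>, \<open>syleaf\<close> and \<open>yerleaf\<close> count nodes with \<open>H\<close> empty, where \<open>G\<close> is respectively
      lone, of length 1, and of length at least 2;
    \<^item> \<open>snuleaf\<close> and \<open>yint\<close> count nodes with \<open>G\<close> empty, where \<open>H\<close> is respectively lone and
      nonempty.

  The first two shapes are exchanged with \<open>G\<close> and \<open>H\<close>. In the others \<open>G\<close> or \<open>H\<close> is
  empty, so nothing is exchanged, and they see of the nonempty forest only whether it is lone and
  whether its length is 1 or at least 2, which mirroring preserves. This is \<open>statistics_mirror_tree\<close>.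

  For the polynomials, \<open>snuleaf\<close> vanishes on trees without young internal nodes: with \<open>G\<close>
  empty, a lone \<open>H\<close> is nonempty. Hence \<open>sleaf\<close> equals \<open>suleaf\<close> there, and the involution
  exchanges the exponents of \<open>u1\<close> and \<open>u3\<close>.
\<close>

section \<open>Trees as binary trees, and the mirror involution\<close>

function mirror :: "ltree list \<Rightarrow> ltree list" where
  "mirror [] = []"
| "mirror (G @ [Node x H]) =
     (if G = [] \<or> H = [] then mirror G @ [Node x (mirror H)]
      else mirror H @ [Node x (mirror G)])"
proof -
  fix P :: bool and F :: "ltree list"
  assume "F = [] \<Longrightarrow> P" and "\<And>G x H. F = G @ [Node x H] \<Longrightarrow> P"
  then show P
    by (metis ltree.exhaust rev_exhaust)
qed auto
termination
  by (relation "measure (size_list size)") auto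

fun mirror_tree :: "ltree \<Rightarrow> ltree" where
  "mirror_tree (Node a F) = Node a (mirror F)"

lemma mirror_eq_Nil_iff [simp]: "mirror F = [] \<longleftrightarrow> F = []"
  by (cases F rule: mirror.cases) auto

lemma mirror_mirror [simp]: "mirror (mirror F) = F"
  by (induction F rule: mirror.induct) auto

lemma length_mirror_eq_1_iff: "length (mirror F) = 1 \<longleftrightarrow> length F = 1"
  by (cases F rule: mirror.cases) auto

lemma length_mirror_ge_2_iff: "length (mirror F) \<ge> 2 \<longleftrightarrow> length F \<ge> 2"
proof -
  have "length L \<ge> 2 \<longleftrightarrow> L \<noteq> [] \<and> length L \<noteq> 1" for L :: "ltree list"
    by (cases L rule: rev_cases) (auto simp: Suc_le_eq)
  then show ?thesis
    by (simp only: mirror_eq_Nil_iff length_mirror_eq_1_iff simp_thms)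
qed

definition lone_leaf :: "ltree list \<Rightarrow> bool" where
  "lone_leaf F \<longleftrightarrow> (\<exists>a. F = [Node a []])"

lemma not_lone_leaf_Nil [simp]: "\<not> lone_leaf []"
  by (simp add: lone_leaf_def)

lemma lone_leaf_mirror_iff [simp]: "lone_leaf (mirror F) \<longleftrightarrow> lone_leaf F"
  by (cases F rule: mirror.cases) (auto simp: lone_leaf_def)

section \<open>Weakly increasing trees\<close>

lemma leaf_Cons_iff:
  "leaf (Node a F) (i # x) \<longleftrightarrow> i < length F \<and> leaf (F ! i) x"
  by (auto simp: leaf_def nodes_def childs_at_def)

lemma leaf_Nil_iff: "leaf (Node a F) [] \<longleftrightarrow> F = []"
  by (simp add: leaf_def nodes_def childs_at_def)

text \<open>
  The path condition speaks of paths to leaves only. A node gets its share of the condition from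
  some leaf below it.
\<close>

lemma exists_leaf: "\<exists>x. leaf t x"
proof (induction t)
  case (Node a F)
  show ?case
  proof (cases F)
    case Nil
    then show ?thesis using leaf_Nil_iff by blast
  next
    case (Cons t F')
    with Node obtain x where "leaf t x" by auto
    with Cons have "leaf (Node a F) (0 # x)" by (simp add: leaf_Cons_iff)
    then show ?thesis by blast
  qed
qed

lemma sorted_path_labels_Cons:
  "sorted (a # path_labels t x) \<longleftrightarrow> a \<le> label t \<and> sorted (path_labels t x)"
  by (cases x) auto

lemma all_address_iff:
  "(\<forall>x. P x) \<longleftrightarrow> P [] \<and> (\<forall>i x. P (i # x))"
  by (metis neq_Nil_conv)

text \<open>
  This trades addresses for structural recursion. Along a path to a leaf of \<open>t\<close>, the label \<open>a\<close>
  only has to be compared with the first label that follows it, that of \<open>t\<close>.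
\<close>

lemma weakly_increasing_Node:
  "weakly_increasing (Node a F) \<longleftrightarrow>
     sorted (rev (map label F)) \<and> (\<forall>t\<in>set F. a \<le> label t \<and> weakly_increasing t)"
proof -
  have paths: "(\<forall>x. leaf (Node a F) x \<longrightarrow> sorted (path_labels (Node a F) x)) \<longleftrightarrow>
      (\<forall>t\<in>set F. a \<le> label t \<and> (\<forall>x. leaf t x \<longrightarrow> sorted (path_labels t x)))"
  proof -
    have "(\<forall>x. leaf (Node a F) x \<longrightarrow> sorted (path_labels (Node a F) x)) \<longleftrightarrow>
        (\<forall>i x. i < length F \<longrightarrow> leaf (F ! i) x \<longrightarrow>
          a \<le> label (F ! i) \<and> sorted (path_labels (F ! i) x))"
      by (subst all_address_iff)
        (auto simp add: leaf_Cons_iff sorted_path_labels_Cons[symmetric] simp del: sorted_simps)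
    also have "\<dots> \<longleftrightarrow> (\<forall>t\<in>set F. \<forall>x. leaf t x \<longrightarrow>
        a \<le> label t \<and> sorted (path_labels t x))"
      by (auto simp: all_set_conv_all_nth)
    finally show ?thesis
      using exists_leaf by blast
  qed
  have siblings: "(\<forall>x\<in>nodes (Node a F). sorted (rev (map label (childs_at (Node a F) x)))) \<longleftrightarrow>
      sorted (rev (map label F)) \<and>
      (\<forall>t\<in>set F. \<forall>x\<in>nodes t. sorted (rev (map label (childs_at t x))))"
  proof -
    have "(\<forall>x\<in>nodes (Node a F). sorted (rev (map label (childs_at (Node a F) x)))) \<longleftrightarrow>
        sorted (rev (map label F)) \<and>
        (\<forall>i x. i < length F \<longrightarrow> x \<in> nodes (F ! i) \<longrightarrow>
          sorted (rev (map label (childs_at (F ! i) x))))"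
      unfolding Ball_def by (subst all_address_iff) (auto simp: nodes_def childs_at_def)
    then show ?thesis
      unfolding all_set_conv_all_nth Ball_def[of "nodes _"] by blast
  qed
  show ?thesis
    unfolding weakly_increasing_def paths siblings by blast
qed

text \<open>
  The labels in \<open>G\<close> are at least \<open>x\<close> as \<open>x\<close> stands to their right, and the children of
  \<open>x\<close> are labeled at least \<open>x\<close> as they lie below it. The two forests thus satisfy the same
  condition, and they may trade places.
\<close>

lemma weakly_increasing_snoc:
  "weakly_increasing (Node a (G @ [Node x H])) \<longleftrightarrow>
     a \<le> x \<and> weakly_increasing (Node x G) \<and> weakly_increasing (Node x H)"
  unfolding weakly_increasing_Node[of a] weakly_increasing_Node[of x G]
  by auto

lemma weakly_increasing_mirror:
  "weakly_increasing (Node a (mirror F)) \<longleftrightarrow> weakly_increasing (Node a F)"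
  by (induction F arbitrary: a rule: mirror.induct) (auto simp: weakly_increasing_snoc)

lemma labels_mirror: "sum_list (map labels (mirror F)) = sum_list (map labels F)"
  by (induction F rule: mirror.induct) auto

lemma mirror_tree_in_wi_trees: "mirror_tree T \<in> wi_trees M \<longleftrightarrow> T \<in> wi_trees M"
  by (cases T) (simp add: wi_trees_def weakly_increasing_mirror labels_mirror)

lemma mirror_tree_mirror_tree: "mirror_tree (mirror_tree T) = T"
  by (cases T) simp

section \<open>Counting nodes by their elder siblings and their children\<close>

text \<open>
  The pair \<open>(p, i)\<close> stands for the non-root node \<open>p @ [i]\<close>, so that its elder siblings and its
  children can both be read off the children of \<open>p\<close>.
\<close>

definition places :: "(ltree list \<Rightarrow> ltree list \<Rightarrow> bool) \<Rightarrow> ltree \<Rightarrow> (nat list \<times> nat) set" where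
  "places D t = {(p, i). p \<in> nodes t \<and> i < length (childs_at t p) \<and>
     D (take i (childs_at t p)) (children (childs_at t p ! i))}"

lemma finite_places: "finite (places D t)"
proof (rule finite_subset)
  show "places D t \<subseteq> Sigma (nodes t) (\<lambda>p. {..<length (childs_at t p)})"
    by (auto simp: places_def)
qed (simp add: finite_nodes)

lemma places_leaf: "places D (Node a []) = {}"
proof -
  have "(p, i) \<notin> places D (Node a [])" for p i
    by (cases p) (auto simp: places_def nodes_def childs_at_def)
  then show ?thesis by auto
qed

lemma in_places_Nil:
  "([], i) \<in> places D (Node a F) \<longleftrightarrow> i < length F \<and> D (take i F) (children (F ! i))"
  by (simp add: places_def nodes_def childs_at_def)

lemma in_places_Cons:
  "(j # p, i) \<in> places D (Node a F) \<longleftrightarrow> j < length F \<and> (p, i) \<in> places D (F ! j)"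
  by (auto simp: places_def nodes_def childs_at_def)

lemma places_relabel_root: "places D (Node a F) = places D (Node b F)"
proof -
  have "(p, i) \<in> places D (Node a F) \<longleftrightarrow> (p, i) \<in> places D (Node b F)" for p i
    by (cases p) (simp_all add: in_places_Nil in_places_Cons)
  then show ?thesis by auto
qed

text \<open>
  Appending a tree on the right changes the elder siblings of no other node, so the count is additive
  over the binary tree.
\<close>

lemma card_places_snoc:
  "card (places D (Node a (G @ [Node x H]))) =
     card (places D (Node a G)) + card (places D (Node x H)) + of_bool (D G H)"
proof -
  let ?old = "places D (Node a G)"
  let ?new = "(\<lambda>(p, i). (length G # p, i)) ` places D (Node x H)"
  let ?top = "if D G H then {([] :: nat list, length G)} else {}"
  have "z \<in> places D (Node a (G @ [Node x H])) \<longleftrightarrow> z \<in> ?old \<union> ?new \<union> ?top" for z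
  proof (cases z)
    case (Pair p i)
    then show ?thesis
      by (cases p) (auto simp: in_places_Nil in_places_Cons nth_append less_Suc_eq)
  qed
  then have split: "places D (Node a (G @ [Node x H])) = ?old \<union> ?new \<union> ?top"
    by blast
  have "?old \<inter> ?new = {}" and "(?old \<union> ?new) \<inter> ?top = {}"
    by (auto simp: in_places_Cons in_places_Nil)
  then have "card (?old \<union> ?new \<union> ?top) = card ?old + card ?new + card ?top"
    using card_Un_disjoint[of "?old \<union> ?new" ?top] card_Un_disjoint[of ?old ?new]
    by (simp only: finite_places finite_Un finite_imageI) (simp split: if_split_asm)
  moreover have "card ?new = card (places D (Node x H))"
    by (rule card_image) (auto simp: inj_on_def)
  moreover have "card ?top = of_bool (D G H)"
    by simp
  ultimately show ?thesis
    unfolding split by linarith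
qed

text \<open>
  The two assumptions say that \<open>D'\<close> holds at the image of a node exactly when \<open>D\<close> holds at the
  node, in the two cases by which \<open>mirror\<close> is defined.
\<close>

lemma card_places_mirror:
  assumes "\<And>G H. G = [] \<or> H = [] \<Longrightarrow> D' (mirror G) (mirror H) \<longleftrightarrow> D G H"
    and "\<And>G H. G \<noteq> [] \<Longrightarrow> H \<noteq> [] \<Longrightarrow> D' (mirror H) (mirror G) \<longleftrightarrow> D G H"
  shows "card (places D' (Node a (mirror F))) = card (places D (Node a F))"
proof (induction F arbitrary: a rule: mirror.induct)
  case 1
  show ?case by (simp add: places_leaf)
next
  case (2 G x H)
  show ?case
  proof (cases "G = [] \<or> H = []")
    case True
    with 2 show ?thesis by (simp add: card_places_snoc assms(1))
  next
    case False
    have "card (places D' (Node a (mirror H))) = card (places D (Node x H))"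
      "card (places D' (Node x (mirror G))) = card (places D (Node a G))"
      using 2(3,4)[OF False] places_relabel_root by metis+
    with False show ?thesis by (simp add: card_places_snoc assms(2))
  qed
qed

lemma card_places_mirror_tree:
  assumes "\<And>G H. G = [] \<or> H = [] \<Longrightarrow> D' (mirror G) (mirror H) \<longleftrightarrow> D G H"
    and "\<And>G H. G \<noteq> [] \<Longrightarrow> H \<noteq> [] \<Longrightarrow> D' (mirror H) (mirror G) \<longleftrightarrow> D G H"
  shows "card (places D' (mirror_tree T)) = card (places D T)"
  by (cases T) (simp add: card_places_mirror[of D' D, OF assms])

section \<open>The statistics as such counts\<close>

lemma is_node_snoc:
  "is_node t (p @ [i]) \<longleftrightarrow> is_node t p \<and> i < length (childs_at t p)"
  by (induction p arbitrary: t) (auto simp: childs_at_def)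

lemma childs_at_snoc: "childs_at t (p @ [i]) = children (childs_at t p ! i)"
  by (induction p arbitrary: t) (auto simp: childs_at_def)

lemma leaf_snoc:
  "leaf t (p @ [i]) \<longleftrightarrow>
     p \<in> nodes t \<and> i < length (childs_at t p) \<and> children (childs_at t p ! i) = []"
  by (auto simp: leaf_def nodes_def is_node_snoc childs_at_snoc)

lemma lone_leaf_iff: "lone_leaf F \<longleftrightarrow> length F = 1 \<and> children (F ! 0) = []"
proof
  assume *: "length F = 1 \<and> children (F ! 0) = []"
  then obtain t where "F = [t]" by (cases F) auto
  with * show "lone_leaf F" by (cases t) (auto simp: lone_leaf_def)
qed (auto simp: lone_leaf_def)

lemma lone_leaf_take_iff:
  "i < length F \<Longrightarrow> lone_leaf (take i F) \<longleftrightarrow> i = 1 \<and> children (F ! 0) = []"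
  by (auto simp: lone_leaf_iff)

lemma old_leaf_iff:
  "old_leaf t x \<longleftrightarrow>
     (\<exists>p. x = p @ [0] \<and> p \<in> nodes t \<and> childs_at t p \<noteq> [] \<and> children (childs_at t p ! 0) = [])"
  by (cases x rule: rev_cases) (auto simp: old_leaf_def leaf_snoc)

lemma singleton_leaf_iff:
  "singleton_leaf t x \<longleftrightarrow> (\<exists>p. x = p @ [0] \<and> p \<in> nodes t \<and> lone_leaf (childs_at t p))"
  by (auto simp: singleton_leaf_def old_leaf_iff lone_leaf_iff)

lemma elder_leaf_iff:
  "elder_leaf t x \<longleftrightarrow>
     (\<exists>p. x = p @ [0] \<and> p \<in> nodes t \<and> length (childs_at t p) \<ge> 2 \<and>
       children (childs_at t p ! 0) = [])"
  by (auto simp: elder_leaf_def old_leaf_iff)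

lemma young_leaf_iff:
  assumes "children t \<noteq> []"
  shows "young_leaf t x \<longleftrightarrow>
     (\<exists>p i. x = p @ [i] \<and> i \<ge> 1 \<and> p \<in> nodes t \<and> i < length (childs_at t p) \<and>
       children (childs_at t p ! i) = [])"
proof (cases x rule: rev_cases)
  case Nil
  with assms show ?thesis by (simp add: young_leaf_def leaf_def childs_at_def)
next
  case (snoc p i)
  then show ?thesis by (auto simp: young_leaf_def old_leaf_def leaf_snoc Suc_le_eq)
qed

text \<open>
  An elder or a singleton internal node is simply one whose leftmost child is a leaf.
\<close>

lemma young_internal_iff:
  "young_internal t p \<longleftrightarrow>
     p \<in> nodes t \<and> childs_at t p \<noteq> [] \<and> children (childs_at t p ! 0) \<noteq> []"
proof -
  have elder: "(\<exists>y. elder_leaf t y \<and> butlast y = p) \<longleftrightarrow>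
      p \<in> nodes t \<and> length (childs_at t p) \<ge> 2 \<and> children (childs_at t p ! 0) = []"
    by (auto simp: elder_leaf_iff)
  have singleton: "(\<exists>y. singleton_leaf t y \<and> butlast y = p) \<longleftrightarrow>
      p \<in> nodes t \<and> lone_leaf (childs_at t p)"
    by (auto simp: singleton_leaf_iff)
  have "length F \<ge> 1 \<longleftrightarrow> F \<noteq> []" "length F \<ge> 2 \<longleftrightarrow> F \<noteq> [] \<and> length F \<noteq> 1" for F :: "ltree list"
    by (cases F; auto simp: Suc_le_eq)+
  then show ?thesis
    unfolding young_internal_def internal_def elder_internal_def singleton_internal_def
      elder singleton lone_leaf_iff by blast
qed

text \<open>
  In each of the following counts the marked node is determined by the counted leaf or internal node
  as follows: for \<open>entleaf\<close> and \<open>etleaf\<close> it is the right neighbour of the elder leaf, for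
  \<open>syleaf\<close> and \<open>yerleaf\<close> the young leaf itself, for \<open>suleaf\<close> and \<open>snuleaf\<close> the parent of the
  singleton leaf, and for \<open>yint\<close> the leftmost child of the young internal node.
\<close>

lemma entleaf_eq_card_places:
  "entleaf t = card (places (\<lambda>G H. lone_leaf G \<and> H \<noteq> []) t)"
  unfolding entleaf_def
  by (rule bij_betw_same_card[OF bij_betw_byWitness
        [where f = "\<lambda>x. (butlast x, 1)" and f' = "\<lambda>(p, i). p @ [0]"]])
    (auto simp: places_def elder_leaf_iff second_child_def leaf_snoc lone_leaf_take_iff)

lemma etleaf_eq_card_places:
  "etleaf t = card (places (\<lambda>G H. lone_leaf G \<and> H = []) t)"
  unfolding etleaf_def
  by (rule bij_betw_same_card[OF bij_betw_byWitness
        [where f = "\<lambda>x. (butlast x, 1)" and f' = "\<lambda>(p, i). p @ [0]"]])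
    (auto simp: places_def elder_leaf_iff second_child_def leaf_snoc lone_leaf_take_iff)

lemma syleaf_eq_card_places:
  assumes "children t \<noteq> []"
  shows "syleaf t = card (places (\<lambda>G H. length G = 1 \<and> H = []) t)"
  unfolding syleaf_def
  by (rule bij_betw_same_card[OF bij_betw_byWitness
        [where f = "\<lambda>x. (butlast x, last x)" and f' = "\<lambda>(p, i). p @ [i]"]])
    (auto simp: places_def young_leaf_iff[OF assms] is_second_child_def)

lemma yerleaf_eq_card_places:
  assumes "children t \<noteq> []"
  shows "yerleaf t = card (places (\<lambda>G H. length G \<ge> 2 \<and> H = []) t)"
  unfolding yerleaf_def
  by (rule bij_betw_same_card[OF bij_betw_byWitness
        [where f = "\<lambda>x. (butlast x, last x)" and f' = "\<lambda>(p, i). p @ [i]"]])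
    (auto simp: places_def young_leaf_iff[OF assms] is_second_child_def)

text \<open>
  The assumption guarantees that the parent of a singleton leaf is not the root, hence that it has a
  parent \<open>p\<close> of its own.
\<close>

lemma singleton_leaf_parent_iff:
  assumes "\<not> lone_leaf (children t)"
  shows "singleton_leaf t x \<longleftrightarrow>
     (\<exists>p i. x = p @ [i, 0] \<and> p \<in> nodes t \<and> i < length (childs_at t p) \<and>
       lone_leaf (children (childs_at t p ! i)))"
proof -
  have "(\<exists>q. x = q @ [0] \<and> q \<in> nodes t \<and> lone_leaf (childs_at t q)) \<longleftrightarrow>
      (\<exists>p i. x = (p @ [i]) @ [0] \<and> p @ [i] \<in> nodes t \<and> lone_leaf (childs_at t (p @ [i])))"
    using assms by (metis childs_at_def rev_exhaust subtree_at.simps(1))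
  then show ?thesis
    by (simp add: singleton_leaf_iff nodes_def is_node_snoc childs_at_snoc conj_assoc)
qed

lemma suleaf_eq_card_places:
  assumes "\<not> lone_leaf (children t)"
  shows "suleaf t = card (places (\<lambda>G H. G \<noteq> [] \<and> lone_leaf H) t)"
  unfolding suleaf_def
  by (rule bij_betw_same_card[OF bij_betw_byWitness
        [where f = "\<lambda>x. (butlast (butlast x), last (butlast x))"
         and f' = "\<lambda>(p, i). p @ [i, 0]"]])
    (auto simp: places_def singleton_leaf_parent_iff[OF assms] has_elder_sibling_def
      butlast_append)

lemma snuleaf_eq_card_places:
  assumes "\<not> lone_leaf (children t)"
  shows "snuleaf t = card (places (\<lambda>G H. G = [] \<and> lone_leaf H) t)"
  unfolding snuleaf_def
  by (rule bij_betw_same_card[OF bij_betw_byWitness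
        [where f = "\<lambda>x. (butlast (butlast x), last (butlast x))"
         and f' = "\<lambda>(p, i). p @ [i, 0]"]])
    (auto simp: places_def singleton_leaf_parent_iff[OF assms] has_elder_sibling_def
      butlast_append)

lemma yint_eq_card_places:
  "yint t = card (places (\<lambda>G H. G = [] \<and> H \<noteq> []) t)"
  unfolding yint_def
  by (rule bij_betw_same_card[OF bij_betw_byWitness
        [where f = "\<lambda>p. (p, 0)" and f' = fst]])
    (auto simp: places_def young_internal_iff)

section \<open>Symmetry of the statistics\<close>

lemma children_mirror_tree: "children (mirror_tree T) = mirror (children T)"
  by (cases T) simp

text \<open>
  With at least three nodes, the tree is neither a single node, whose root would be a young leaf
  without a parent, nor a single edge, whose singleton leaf has the root as its parent.
\<close>

lemma children_wi_tree:
  assumes "T \<in> wi_trees M" and "size M \<ge> 2"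
  shows "children T \<noteq> []" and "\<not> lone_leaf (children T)"
proof -
  obtain a F where T: "T = Node a F" by (cases T)
  have "add_mset a (sum_list (map labels F)) = add_mset 0 M"
    using assms(1) by (simp add: wi_trees_def T)
  from arg_cong[OF this, of size] have "size (sum_list (map labels F)) = size M"
    by simp
  with assms(2) show "children T \<noteq> []" and "\<not> lone_leaf (children T)"
    by (auto simp: T lone_leaf_def)
qed

lemma statistics_mirror_tree:
  assumes "children T \<noteq> []" and "\<not> lone_leaf (children T)"
  shows "snuleaf (mirror_tree T) = snuleaf T"
    and "etleaf (mirror_tree T) = etleaf T"
    and "syleaf (mirror_tree T) = syleaf T"
    and "yerleaf (mirror_tree T) = yerleaf T"
    and "suleaf (mirror_tree T) = entleaf T"
    and "entleaf (mirror_tree T) = suleaf T"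
    and "yint (mirror_tree T) = yint T"
  unfolding
    snuleaf_eq_card_places[OF assms(2)]
    snuleaf_eq_card_places[of "mirror_tree T", unfolded children_mirror_tree lone_leaf_mirror_iff,
      OF assms(2)]
    suleaf_eq_card_places[OF assms(2)]
    suleaf_eq_card_places[of "mirror_tree T", unfolded children_mirror_tree lone_leaf_mirror_iff,
      OF assms(2)]
    syleaf_eq_card_places[OF assms(1)]
    syleaf_eq_card_places[of "mirror_tree T", unfolded children_mirror_tree mirror_eq_Nil_iff,
      OF assms(1)]
    yerleaf_eq_card_places[OF assms(1)]
    yerleaf_eq_card_places[of "mirror_tree T", unfolded children_mirror_tree mirror_eq_Nil_iff,
      OF assms(1)]
    etleaf_eq_card_places entleaf_eq_card_places yint_eq_card_places
  by (rule card_places_mirror_tree;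
      auto simp: length_mirror_eq_1_iff[simplified] length_mirror_ge_2_iff; fail)+

text \<open>
  If the parent of a singleton leaf is a leftmost child, then its own parent is young internal.
\<close>

lemma snuleaf_eq_0_of_yint_eq_0:
  assumes "\<not> lone_leaf (children T)" and "yint T = 0"
  shows "snuleaf T = 0"
proof -
  have "places (\<lambda>G H. G = [] \<and> lone_leaf H) T \<subseteq> places (\<lambda>G H. G = [] \<and> H \<noteq> []) T"
    by (auto simp: places_def lone_leaf_def)
  from card_mono[OF finite_places this] show ?thesis
    using assms by (simp add: snuleaf_eq_card_places yint_eq_card_places)
qed

lemma sleaf_eq_suleaf_plus_snuleaf: "sleaf T = suleaf T + snuleaf T"
proof -
  have "{x. singleton_leaf T x} \<subseteq> nodes T"
    by (auto simp: singleton_leaf_def old_leaf_def leaf_def)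
  then have "finite {x. singleton_leaf T x}"
    using finite_nodes finite_subset by blast
  then have "card ({x. singleton_leaf T x \<and> has_elder_sibling (butlast x)} \<union>
      {x. singleton_leaf T x \<and> \<not> has_elder_sibling (butlast x)}) = suleaf T + snuleaf T"
    unfolding suleaf_def snuleaf_def by (intro card_Un_disjoint) auto
  moreover have "{x. singleton_leaf T x \<and> has_elder_sibling (butlast x)} \<union>
      {x. singleton_leaf T x \<and> \<not> has_elder_sibling (butlast x)} = {x. singleton_leaf T x}"
    by blast
  ultimately show ?thesis
    by (simp add: sleaf_def)
qed

lemma statistics_mirror_wi_tree:
  assumes "T \<in> wi_trees M" and "size M \<ge> 2"
  shows "snuleaf (mirror_tree T) = snuleaf T"
    and "etleaf (mirror_tree T) = etleaf T"
    and "syleaf (mirror_tree T) = syleaf T"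
    and "yerleaf (mirror_tree T) = yerleaf T"
    and "suleaf (mirror_tree T) = entleaf T"
    and "entleaf (mirror_tree T) = suleaf T"
    and "yint (mirror_tree T) = yint T"
  by (rule statistics_mirror_tree[OF children_wi_tree[OF assms]])+

lemma involution_on_wi_trees: "involution_on (wi_trees M) mirror_tree"
  by (simp add: involution_on_def mirror_tree_in_wi_trees mirror_tree_mirror_tree)

lemma involution_on_A_trees: "size M \<ge> 2 \<Longrightarrow> involution_on (A_trees M) mirror_tree"
  by (auto simp: involution_on_def A_trees_def mirror_tree_in_wi_trees mirror_tree_mirror_tree
      statistics_mirror_wi_tree)

lemma M_poly_symmetric:
  fixes u1 u2 u3 v1 v2 :: "'a :: comm_semiring_1"
  assumes "n \<ge> 1"
  shows "M_poly n u1 u2 u3 v1 v2 = M_poly n u3 u2 u1 v1 v2"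
proof -
  define M :: "nat multiset" where "M = replicate_mset (n + 1) 1"
  have M: "size M \<ge> 2"
    using assms by (simp add: M_def)
  have closed: "mirror_tree T \<in> A_trees M" if "T \<in> A_trees M" for T
    using involution_on_A_trees[OF M] that by (auto simp: involution_on_def)
  have sleaf: "sleaf T = suleaf T" if "T \<in> A_trees M" for T
    using that snuleaf_eq_0_of_yint_eq_0[OF children_wi_tree(2)[OF _ M]]
    by (simp add: A_trees_def sleaf_eq_suleaf_plus_snuleaf)
  show ?thesis
    unfolding M_poly_def M_def[symmetric]
  proof (rule sum.reindex_bij_witness[where i = mirror_tree and j = mirror_tree])
    fix T assume T: "T \<in> A_trees M"
    then have "T \<in> wi_trees M" by (simp add: A_trees_def)
    then show "u3 ^ sleaf (mirror_tree T) * u2 ^ etleaf (mirror_tree T) *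
        u1 ^ entleaf (mirror_tree T) * v1 ^ yerleaf (mirror_tree T) *
        v2 ^ syleaf (mirror_tree T) =
        u1 ^ sleaf T * u2 ^ etleaf T * u3 ^ entleaf T * v1 ^ yerleaf T * v2 ^ syleaf T"
      by (simp add: sleaf T closed statistics_mirror_wi_tree[OF _ M] mult_ac)
  qed (simp_all add: closed mirror_tree_mirror_tree)
qed

theorem theorem1p7:
  shows "(\<forall>M. label_multiset M \<and> size M \<ge> 2 \<longrightarrow>
           (\<exists>\<Psi>. involution_on (wi_trees M) \<Psi> \<and>
              (\<forall>T\<in>wi_trees M.
                 (snuleaf (\<Psi> T), etleaf (\<Psi> T), syleaf (\<Psi> T), yerleaf (\<Psi> T))
                   = (snuleaf T, etleaf T, syleaf T, yerleaf T) \<and>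
                 (suleaf (\<Psi> T), entleaf (\<Psi> T)) = (entleaf T, suleaf T) \<and>
                 yint (\<Psi> T) = yint T) \<and>
              involution_on (A_trees M) \<Psi>)) \<and>
         (\<forall>n\<ge>2. \<forall>u1 u2 u3 v1 v2 :: 'a :: comm_semiring_1.
           M_poly n u1 u2 u3 v1 v2 = M_poly n u3 u2 u1 v1 v2)"
proof (intro conjI allI impI)
  fix M assume "label_multiset M \<and> size M \<ge> 2"
  then have M: "size M \<ge> 2" by simp
  show "\<exists>\<Psi>. involution_on (wi_trees M) \<Psi> \<and>
              (\<forall>T\<in>wi_trees M.
                 (snuleaf (\<Psi> T), etleaf (\<Psi> T), syleaf (\<Psi> T), yerleaf (\<Psi> T))
                   = (snuleaf T, etleaf T, syleaf T, yerleaf T) \<and>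
                 (suleaf (\<Psi> T), entleaf (\<Psi> T)) = (entleaf T, suleaf T) \<and>
                 yint (\<Psi> T) = yint T) \<and>
              involution_on (A_trees M) \<Psi>"
  proof (rule exI[of _ mirror_tree], intro conjI ballI)
    show "involution_on (wi_trees M) mirror_tree"
      by (rule involution_on_wi_trees)
    show "involution_on (A_trees M) mirror_tree"
      by (rule involution_on_A_trees[OF M])
  qed (simp_all add: statistics_mirror_wi_tree[OF _ M])
next
  fix n :: nat and u1 u2 u3 v1 v2 :: 'a
  assume "n \<ge> 2"
  then show "M_poly n u1 u2 u3 v1 v2 = M_poly n u3 u2 u1 v1 v2"
    by (intro M_poly_symmetric) simp
qed

end
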